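(* Assume the following (Small Derivatives Conjecture): there is an absolute constant $0<\eta<1$ such that for all but finitely many triples of coprime positive integers $(a,b,c)$ satisfying $a+b=c$ and not of the form $(1,N,q)$ with $q$ prime (up to order), there is $\psi\in\mathscr{T}(a,b)$ such that $a,b$ are $\psi$-independent and $\|\psi\|<c^\eta$. Then there is a positive integer $n_0$ such that for all $n\ge n_0$ the following holds: if $a,b,c$ are coprime positive integers, then $a^n+b^n\neq c^n$.
   Context: For a prime $p$, $v_p$ is the $p$-adic valuation. For a non-zero integer $n$, $\mathrm{supp}(n)$ is the set of primes dividing $n$. Let $\Omega$ be the free $\mathbb{Z}$-module on symbols $\xi_p$, one for each prime $p$. Define $\mathrm{d}:\mathbb{Z}\to\Omega$ by $\mathrm{d}0=0$ and $\mathrm{d}n=\sum_{p\mid n}\frac{n\,v_p(n)}{p}\,\xi_p$ for $n\ne 0$ (the coefficients are integers). For a $\mathbb{Z}$-linear map $\psi:\Omega\to\mathbb{Z}$ put $\|\psi\|=\sup_p|\psi(\xi_p)|$. Let $\mathscr{T}$ be the $\mathbb{Z}$-module of all $\mathbb{Z}$-linear $\psi:\Omega\to\mathbb{Z}$ with $\|\psi\|<\infty$. For $\psi\in\mathscr{T}$ let $\mathrm{d}^\psi=\psi\circ\mathrm{d}:\mathbb{Z}\to\mathbb{Z}$ and $\mathrm{supp}(\psi)=\{p:\psi(\xi_p)\neq0\}$. For positive integers $a,b$, $$\mathscr{T}(a,b)=\{\psi\in\mathscr{T}:\ \mathrm{supp}(\psi)\subseteq\mathrm{supp}(ab(a+b))\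 \text{and}\ \mathrm{d}^\psi(a+b)=\mathrm{d}^\psi a+\mathrm{d}^\psi b\}.$$ Integers $a,b$ are $\psi$-independent if $W^\psi(a,b):=a\,\mathrm{d}^\psi b-b\,\mathrm{d}^\psi a\neq 0$. A triple is "of the form $(1,N,q)$ up to order" if some permutation of it equals $(1,N,q)$ with $N$ a positive integer and $q$ prime. *)

theory Defs
  imports Complex_Main "HOL-Library.Poly_Mapping" "HOL-Library.Multiset"
    "HOL-Computational_Algebra.Primes"
begin

typedef prime_number = "{p::int. prime p}"
  morphisms int_of_prime prime_of_int
  by (auto intro: exI[of _ 2])

text \<open>The free \<open>\<int>\<close>-module on the primes; the symbol \<open>\<xi>\<^sub>p\<close> is \<open>frag_of p\<close>.\<close>

type_synonym omega = "prime_number \<Rightarrow>\<^sub>0 int"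

text \<open>Only meaningful for \<open>n \<noteq> 0\<close>; then this is a finite set.\<close>

definition supp :: "int \<Rightarrow> prime_number set" where
  "supp n = {p. int_of_prime p dvd n}"

text \<open>The division by \<open>p\<close> is exact, since \<open>p\<close> divides \<open>n\<close> in every summand.\<close>

definition arith_d :: "int \<Rightarrow> omega" where
  "arith_d n = (if n = 0 then 0 else
     (\<Sum>p\<in>supp n. frag_cmul
        (n * int (multiplicity (int_of_prime p) n) div int_of_prime p) (frag_of p)))"

definition dual_norm :: "(omega \<Rightarrow> int) \<Rightarrow> real" where
  "dual_norm \<psi> = (SUP p. real_of_int \<bar>\<psi> (frag_of p)\<bar>)"

text \<open>The boundedness condition says that \<open>dual_norm \<psi>\<close> is finite; it is
  stated separately because the real supremum of an unbounded set is a junk value.\<close>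

definition bounded_forms :: "(omega \<Rightarrow> int) set" where
  "bounded_forms = {\<psi>. module_hom frag_cmul (*) \<psi> \<and>
     bdd_above (range (\<lambda>p. real_of_int \<bar>\<psi> (frag_of p)\<bar>))}"

definition deriv_along :: "(omega \<Rightarrow> int) \<Rightarrow> int \<Rightarrow> int" where
  "deriv_along \<psi> = \<psi> \<circ> arith_d"

definition supp_form :: "(omega \<Rightarrow> int) \<Rightarrow> prime_number set" where
  "supp_form \<psi> = {p. \<psi> (frag_of p) \<noteq> 0}"

definition tangent_forms :: "int \<Rightarrow> int \<Rightarrow> (omega \<Rightarrow> int) set" where
  "tangent_forms a b = {\<psi> \<in> bounded_forms.
     supp_form \<psi> \<subseteq> supp (a * b * (a + b)) \<and>
     deriv_along \<psi> (a + b) = deriv_along \<psi> a + deriv_along \<psi> b}"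

definition wronskian :: "(omega \<Rightarrow> int) \<Rightarrow> int \<Rightarrow> int \<Rightarrow> int" where
  "wronskian \<psi> a b = a * deriv_along \<psi> b - b * deriv_along \<psi> a"

definition psi_independent :: "(omega \<Rightarrow> int) \<Rightarrow> int \<Rightarrow> int \<Rightarrow> bool" where
  "psi_independent \<psi> a b \<longleftrightarrow> wronskian \<psi> a b \<noteq> 0"

text \<open>Equality of multisets expresses equality of triples up to order.\<close>

definition one_N_prime_form :: "int \<Rightarrow> int \<Rightarrow> int \<Rightarrow> bool" where
  "one_N_prime_form a b c \<longleftrightarrow> (\<exists>N q. N > 0 \<and> prime q \<and> {#a, b, c#} = {#1, N, q#})"

definition small_derivatives_conjecture :: bool where
  "small_derivatives_conjecture \<longleftrightarrow>
     (\<exists>\<eta>::real. 0 < \<eta> \<and> \<eta> < 1 \<and>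
        finite {(a, b, c). a > 0 \<and> b > 0 \<and> c > 0 \<and> Gcd {a, b, c} = 1 \<and> a + b = c \<and>
          \<not> one_N_prime_form a b c \<and>
          \<not> (\<exists>\<psi>\<in>tangent_forms a b. psi_independent \<psi> a b \<and>
                dual_norm \<psi> < real_of_int c powr \<eta>)})"

lemma finite_supp: "n \<noteq> 0 \<Longrightarrow> finite (supp n)"
proof -
  assume "n \<noteq> 0"
  then have "finite (int_of_prime ` supp n)"
    by (intro finite_subset[OF _ finite_divisors_int[of n]]) (auto simp: supp_def)
  then show ?thesis
    by (rule finite_imageD) (simp add: inj_on_def int_of_prime_inject)
qed

lemma lookup_arith_d:
  assumes "n \<noteq> 0"
  shows "Poly_Mapping.lookup (arith_d n) p =
    n * int (multiplicity (int_of_prime p) n) div int_of_prime p"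
proof -
  have "Poly_Mapping.lookup (arith_d n) p = (\<Sum>q\<in>supp n. if q = p then
      n * int (multiplicity (int_of_prime q) n) div int_of_prime q else 0)"
    using assms by (auto simp: arith_d_def lookup_sum lookup_single when_def intro!: sum.cong)
  also have "\<dots> = n * int (multiplicity (int_of_prime p) n) div int_of_prime p"
    using finite_supp[OF assms]
    by (subst sum.delta) (auto simp: supp_def not_dvd_imp_multiplicity_0)
  finally show ?thesis .
qed

lemma module_omega: "module frag_cmul"
  by unfold_locales (auto simp: frag_cmul_distrib frag_cmul_distrib2)

end

theory Submission
  imports Defs
begin

text \<open>
  Apply the conjecture to \<open>(a\<^sup>n, b\<^sup>n, c\<^sup>n)\<close>: no entry is prime for \<open>n \<ge> 2\<close>, and since
  \<open>c\<^sup>n \<ge> 2\<^sup>n\<close> only finitely many \<open>n\<close> are affected by the exceptional triples. Let \<open>D\<close>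
  be the resulting derivation. Leibniz' rule and the additivity of \<open>D\<close> at \<open>a\<^sup>n + b\<^sup>n\<close>, divided by
  \<open>n\<close>, give, writing \<open>W(x, y) = x D y - y D x\<close>, that \<open>b\<^sup>n\<^sup>-\<^sup>1 W(a, b) = c\<^sup>n\<^sup>-\<^sup>1 W(a, c)\<close>. By
  coprimality \<open>c\<^sup>n\<^sup>-\<^sup>1\<close> divides the nonzero integer \<open>W(a, b)\<close>. But \<open>|D m| \<le> \<parallel>\<psi>\<parallel> m\<^sup>2\<close>
  bounds \<open>|W(a, b)|\<close> by \<open>2 c\<^sup>3 \<parallel>\<psi>\<parallel>\<close>, which is less than the \<open>4 + \<eta> n\<close>-th power of \<open>c\<close>:
  impossible for large \<open>n\<close> because \<open>\<eta> < 1\<close>.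
\<close>

section \<open>The arithmetic differential on products, units and primes\<close>

lemma prime_int_of_prime [simp]: "prime (int_of_prime p)"
  using int_of_prime[of p] by simp

text \<open>Valuations add on products. All divisions are exact: \<open>p\<close> divides
  \<open>k * multiplicity p k\<close> for every \<open>k\<close>, because the valuation vanishes
  when \<open>p\<close> does not divide \<open>k\<close>.\<close>

lemma arith_d_coeff_mult:
  assumes "prime (p::int)" "m \<noteq> 0" "n \<noteq> 0"
  shows "m * n * int (multiplicity p (m * n)) div p =
    m * (n * int (multiplicity p n) div p) + n * (m * int (multiplicity p m) div p)"
proof -
  have dvd: "p dvd k * int (multiplicity p k)" for k :: int
    by (cases "p dvd k") (auto simp: not_dvd_imp_multiplicity_0)
  have "multiplicity p (m * n) = multiplicity p m + multiplicity p n"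
    using assms by (intro prime_elem_multiplicity_mult_distrib) auto
  then have "m * n * int (multiplicity p (m * n)) =
      m * (n * int (multiplicity p n)) + n * (m * int (multiplicity p m))"
    by (simp add: algebra_simps)
  then show ?thesis
    using dvd by (simp add: div_mult_swap)
qed

lemma arith_d_mult:
  "arith_d (m * n) = frag_cmul m (arith_d n) + frag_cmul n (arith_d m)"
proof (cases "m = 0 \<or> n = 0")
  case True
  then show ?thesis by (auto simp: arith_d_def)
next
  case False
  then show ?thesis
    by (intro poly_mapping_eqI) (simp add: lookup_arith_d lookup_add arith_d_coeff_mult)
qed

lemma arith_d_unit:
  assumes "is_unit n"
  shows "arith_d n = 0"
  using assms by (intro poly_mapping_eqI) (auto simp: lookup_arith_d multiplicity_unit_right)

lemma arith_d_prime: "arith_d (int_of_prime p) = frag_of p"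
proof (intro poly_mapping_eqI)
  fix q
  have "int_of_prime p \<noteq> 0"
    using prime_int_of_prime[of p] by fastforce
  moreover from this have "multiplicity (int_of_prime p) (int_of_prime p) = 1"
    using not_prime_unit[of "int_of_prime p"] prime_int_of_prime[of p]
    by (intro multiplicity_self) blast+
  moreover have "int_of_prime p \<noteq> int_of_prime q" if "p \<noteq> q"
    using that by (simp add: int_of_prime_inject)
  ultimately show "Poly_Mapping.lookup (arith_d (int_of_prime p)) q =
      Poly_Mapping.lookup (frag_of p) q"
    by (cases "p = q")
      (auto simp: lookup_arith_d lookup_single prime_multiplicity_other)
qed

section \<open>Integer derivations given by bounded forms\<close>

lemma bounded_forms_add: "\<psi> \<in> bounded_forms \<Longrightarrow> \<psi> (x + y) = \<psi> x + \<psi> y"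
  and bounded_forms_scale: "\<psi> \<in> bounded_forms \<Longrightarrow> \<psi> (frag_cmul k x) = k * \<psi> x"
  and bounded_forms_zero: "\<psi> \<in> bounded_forms \<Longrightarrow> \<psi> 0 = 0"
  by (auto simp: bounded_forms_def module_hom.add module_hom.scale module_hom.zero)

text \<open>Boundedness of the range makes the real supremum a genuine upper bound.\<close>

lemma abs_le_dual_norm:
  assumes "\<psi> \<in> bounded_forms"
  shows "\<bar>real_of_int (\<psi> (frag_of p))\<bar> \<le> dual_norm \<psi>"
  using assms cSUP_upper[of p UNIV "\<lambda>p. real_of_int \<bar>\<psi> (frag_of p)\<bar>"]
  by (simp add: bounded_forms_def dual_norm_def)

lemma deriv_along_mult:
  assumes "\<psi> \<in> bounded_forms"
  shows "deriv_along \<psi> (m * n) = m * deriv_along \<psi> n + n * deriv_along \<psi> m"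
  using assms
  by (simp add: deriv_along_def arith_d_mult bounded_forms_add bounded_forms_scale)

lemma deriv_along_unit:
  "\<psi> \<in> bounded_forms \<Longrightarrow> is_unit n \<Longrightarrow> deriv_along \<psi> n = 0"
  by (simp add: deriv_along_def arith_d_unit bounded_forms_zero del: zdvd1_eq)

text \<open>The power rule; the exponent \<open>Suc k\<close> avoids truncated subtraction.\<close>

lemma deriv_along_power_Suc:
  assumes "\<psi> \<in> bounded_forms"
  shows "deriv_along \<psi> (m ^ Suc k) = int (Suc k) * m ^ k * deriv_along \<psi> m"
proof (induction k)
  case (Suc k)
  have "deriv_along \<psi> (m ^ Suc (Suc k)) =
      m * deriv_along \<psi> (m ^ Suc k) + m ^ Suc k * deriv_along \<psi> m"
    unfolding power_Suc[of m "Suc k"] by (rule deriv_along_mult[OF assms])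
  then show ?case
    using Suc.IH by (simp add: algebra_simps)
qed simp

section \<open>Size of derivatives and Wronskians\<close>

text \<open>Induction on the prime factorisation: a prime has derivative at most the norm, and
  Leibniz' rule controls each further prime factor. The crude exponent 2 costs only a fixed power of
  \<open>c\<close> later.\<close>

lemma abs_deriv_along_le:
  assumes \<psi>: "\<psi> \<in> bounded_forms"
  shows "\<bar>real_of_int (deriv_along \<psi> m)\<bar> \<le> dual_norm \<psi> * (real_of_int m)\<^sup>2"
proof -
  have K: "0 \<le> dual_norm \<psi>"
    using abs_le_dual_norm[OF \<psi>] abs_ge_zero order_trans by blast
  show ?thesis
  proof (induction m rule: prime_divisors_induct)
    case zero
    show ?case
      by (simp add: deriv_along_def arith_d_def bounded_forms_zero[OF \<psi>])
  next
    case (unit m)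
    then show ?case
      using K by (simp add: deriv_along_unit[OF \<psi>] del: zdvd1_eq)
  next
    case (factor p m)
    define P where "P = real_of_int p"
    define M where "M = real_of_int m"
    obtain q where q: "p = int_of_prime q"
      using \<open>prime p\<close> by (metis int_of_prime_cases mem_Collect_eq)
    have "P \<ge> 2"
      using prime_ge_2_int[OF \<open>prime p\<close>] by (simp add: P_def)
    have "deriv_along \<psi> p = \<psi> (frag_of q)"
      by (simp add: deriv_along_def q arith_d_prime)
    then have "\<bar>real_of_int (deriv_along \<psi> p)\<bar> \<le> dual_norm \<psi>"
      using abs_le_dual_norm[OF \<psi>] by simp
    moreover have "real_of_int (deriv_along \<psi> (p * m)) =
        P * real_of_int (deriv_along \<psi> m) + M * real_of_int (deriv_along \<psi> p)"
      by (simp add: deriv_along_mult[OF \<psi>] P_def M_def)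
    ultimately have "\<bar>real_of_int (deriv_along \<psi> (p * m))\<bar> \<le>
        P * (dual_norm \<psi> * M\<^sup>2) + \<bar>M\<bar> * dual_norm \<psi>"
      using factor.IH \<open>P \<ge> 2\<close> unfolding M_def[symmetric]
      by (auto simp: abs_mult intro!: order_trans[OF abs_triangle_ineq] add_mono mult_mono)
    also have "\<dots> = dual_norm \<psi> * (P * M\<^sup>2 + \<bar>M\<bar>)"
      by (simp add: algebra_simps)
    also have "\<dots> \<le> dual_norm \<psi> * (P * M)\<^sup>2"
    proof (rule mult_left_mono[OF _ K])
      \<comment> \<open>This relies on \<open>M\<close> being an integer.\<close>
      have "\<bar>M\<bar> \<le> M\<^sup>2"
      proof (cases "m = 0")
        case False
        then have "1 \<le> \<bar>M\<bar>"
          unfolding M_def by linarith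
        then have "\<bar>M\<bar> * 1 \<le> \<bar>M\<bar> * \<bar>M\<bar>"
          by (intro mult_left_mono) auto
        then show ?thesis by (simp add: power2_eq_square)
      qed (simp add: M_def)
      moreover have "(P + 1) * M\<^sup>2 \<le> P\<^sup>2 * M\<^sup>2"
      proof (rule mult_right_mono)
        have "2 * P \<le> P * P"
          using \<open>P \<ge> 2\<close> by (intro mult_right_mono) auto
        then show "P + 1 \<le> P\<^sup>2"
          using \<open>P \<ge> 2\<close> unfolding power2_eq_square by linarith
      qed simp
      ultimately show "P * M\<^sup>2 + \<bar>M\<bar> \<le> (P * M)\<^sup>2"
        by (simp add: algebra_simps power_mult_distrib)
    qed
    finally show ?case
      by (simp add: P_def M_def)
  qed
qed

lemma abs_wronskian_le:
  assumes \<psi>: "\<psi> \<in> bounded_forms"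
    and "0 \<le> a" "a \<le> c" "0 \<le> b" "b \<le> c"
  shows "\<bar>real_of_int (wronskian \<psi> a b)\<bar> \<le> 2 * real_of_int c ^ 3 * dual_norm \<psi>"
proof -
  have K: "0 \<le> dual_norm \<psi>"
    using abs_le_dual_norm[OF \<psi>] abs_ge_zero order_trans by blast
  have *: "real_of_int x * \<bar>real_of_int (deriv_along \<psi> y)\<bar> \<le> real_of_int c ^ 3 * dual_norm \<psi>"
    if "0 \<le> x" "x \<le> c" "0 \<le> y" "y \<le> c" for x y
  proof -
    have "real_of_int x * \<bar>real_of_int (deriv_along \<psi> y)\<bar> \<le>
        real_of_int c * (dual_norm \<psi> * (real_of_int c)\<^sup>2)"
      using that K
      by (intro mult_mono order_trans[OF abs_deriv_along_le[OF \<psi>]] mult_left_mono power_mono) auto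
    then show ?thesis
      by (simp add: power2_eq_square power3_eq_cube algebra_simps)
  qed
  have "\<bar>real_of_int (wronskian \<psi> a b)\<bar> \<le>
      real_of_int a * \<bar>real_of_int (deriv_along \<psi> b)\<bar> +
      real_of_int b * \<bar>real_of_int (deriv_along \<psi> a)\<bar>"
    using assms abs_triangle_ineq4[of "real_of_int a * real_of_int (deriv_along \<psi> b)"
        "real_of_int b * real_of_int (deriv_along \<psi> a)"]
    by (simp add: wronskian_def abs_mult)
  then show ?thesis
    using *[of a b] *[of b a] assms by linarith
qed

section \<open>Divisibility consequences of the Fermat equation\<close>

text \<open>A common prime factor of \<open>b\<close> and \<open>c\<close> divides
  \<open>a ^ n = c ^ n - b ^ n\<close>, hence \<open>a\<close>, contradicting the joint gcd.\<close>

lemma fermat_coprime: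
  fixes a b c :: int
  assumes "Gcd {a, b, c} = 1" "n > 0" "a ^ n + b ^ n = c ^ n"
  shows "coprime b c"
proof (rule ccontr)
  assume "\<not> coprime b c"
  then obtain d where d: "d dvd b" "d dvd c" "\<not> is_unit d"
    using not_coprimeE by blast
  then have "\<bar>d\<bar> \<noteq> 1"
    by simp
  then obtain p where "prime p" "p dvd d"
    using prime_factor_int by blast
  with d have p: "prime p" "p dvd b" "p dvd c"
    by (auto intro: dvd_trans)
  then have "p dvd c ^ n - b ^ n"
    using \<open>n > 0\<close> by (intro dvd_diff) (auto intro: dvd_trans dvd_power)
  then have "p dvd a ^ n"
    using assms(3) by (metis add_diff_cancel_right')
  then have "p dvd a"
    using p(1) prime_dvd_power by blast
  then have "p dvd Gcd {a, b, c}"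
    using p by simp
  then show False
    using assms(1) p(1) by (metis not_prime_unit)
qed

lemma power_dvd_wronskian:
  assumes \<psi>: "\<psi> \<in> bounded_forms"
    and coprime: "coprime b c"
    and eq: "a ^ Suc k + b ^ Suc k = c ^ Suc k"
    and additive: "deriv_along \<psi> (c ^ Suc k) =
      deriv_along \<psi> (a ^ Suc k) + deriv_along \<psi> (b ^ Suc k)"
  shows "c ^ k dvd wronskian \<psi> a b"
proof -
  have "int (Suc k) * (c ^ k * deriv_along \<psi> c) =
      int (Suc k) * (a ^ k * deriv_along \<psi> a + b ^ k * deriv_along \<psi> b)"
    using additive unfolding deriv_along_power_Suc[OF \<psi>]
    by (simp only: distrib_left mult.assoc)
  then have "c ^ k * deriv_along \<psi> c = a ^ k * deriv_along \<psi> a + b ^ k * deriv_along \<psi> b"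
    by (simp only: mult_cancel_left) simp
  then have "b ^ k * deriv_along \<psi> b = c ^ k * deriv_along \<psi> c - a ^ k * deriv_along \<psi> a"
    by simp
  moreover have "b * b ^ k = c * c ^ k - a * a ^ k"
    using eq by simp
  moreover have "b ^ k * wronskian \<psi> a b =
      a * (b ^ k * deriv_along \<psi> b) - (b * b ^ k) * deriv_along \<psi> a"
    by (simp add: wronskian_def algebra_simps)
  \<comment> \<open>After substituting for \<open>b ^ k * deriv_along \<psi> b\<close> and
    \<open>b * b ^ k\<close>, the two terms \<open>a * a ^ k * deriv_along \<psi> a\<close>
    cancel.\<close>
  ultimately have "b ^ k * wronskian \<psi> a b = c ^ k * wronskian \<psi> a c"
    by (simp only:) (simp add: wronskian_def algebra_simps)
  then have "c ^ k dvd b ^ k * wronskian \<psi> a b"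
    by simp
  moreover have "coprime (c ^ k) (b ^ k)"
    using coprime by (simp add: coprime_commute)
  ultimately show ?thesis
    by (simp add: coprime_dvd_mult_right_iff)
qed

text \<open>Carries independence of the powers down to \<open>a\<close> and
  \<open>b\<close>.\<close>

lemma wronskian_power_Suc:
  assumes "\<psi> \<in> bounded_forms"
  shows "wronskian \<psi> (a ^ Suc k) (b ^ Suc k) =
    int (Suc k) * a ^ k * b ^ k * wronskian \<psi> a b"
  unfolding wronskian_def deriv_along_power_Suc[OF assms] by (simp add: algebra_simps)

lemma not_one_N_prime_form_power:
  assumes "n \<ge> 2"
  shows "\<not> one_N_prime_form (a ^ n) (b ^ n) (c ^ n)"
proof
  assume "one_N_prime_form (a ^ n) (b ^ n) (c ^ n)"
  then obtain N q where q: "prime q" "{#a ^ n, b ^ n, c ^ n#} = {#1, N, q#}"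
    unfolding one_N_prime_form_def by blast
  have "q \<in># {#a ^ n, b ^ n, c ^ n#}"
    unfolding q(2) by simp
  then obtain x where "q = x ^ n"
    by auto
  then show False
    using q(1) assms by (simp add: prime_power_iff)
qed

section \<open>Comparison of exponents and conclusion\<close>

text \<open>Divisibility and size give \<open>c ^ (n - 1) < c powr (4 + n * \<eta>)\<close>, so
  \<open>n * (1 - \<eta>) < 5\<close>; this is where the constant 5 comes from.\<close>

lemma no_fermat_solution_of_form:
  fixes a b c :: int and \<eta> :: real
  assumes pos: "a > 0" "b > 0" "c > 0" and "coprime b c"
    and eq: "a ^ n + b ^ n = c ^ n"
    and n: "real n * (1 - \<eta>) \<ge> 5" "n > 0"
    and \<psi>: "\<psi> \<in> tangent_forms (a ^ n) (b ^ n)" "psi_independent \<psi> (a ^ n) (b ^ n)"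
    and small: "dual_norm \<psi> < real_of_int (c ^ n) powr \<eta>"
  shows False
proof -
  obtain k where k: "n = Suc k"
    using n(2) gr0_implies_Suc by blast
  have b: "\<psi> \<in> bounded_forms"
    and additive: "deriv_along \<psi> (c ^ n) = deriv_along \<psi> (a ^ n) + deriv_along \<psi> (b ^ n)"
    using \<psi>(1) by (simp_all add: tangent_forms_def eq)
  have "a ^ n < c ^ n" "b ^ n < c ^ n"
    using eq zero_less_power[OF pos(1), of n] zero_less_power[OF pos(2), of n] by linarith+
  then have "a < c" "b < c"
    using pos power_less_imp_less_base[of _ n c] by auto
  then have "c \<ge> 2"
    using pos by linarith
  define C where "C = real_of_int c"
  have "C \<ge> 2"
    using \<open>c \<ge> 2\<close> by (simp add: C_def)
  have "wronskian \<psi> a b \<noteq> 0"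
    using \<psi>(2) wronskian_power_Suc[OF b] by (auto simp: psi_independent_def k)
  moreover have "c ^ k dvd wronskian \<psi> a b"
    using power_dvd_wronskian[OF b \<open>coprime b c\<close>] eq additive by (simp only: k)
  ultimately have "c ^ k \<le> \<bar>wronskian \<psi> a b\<bar>"
    using dvd_imp_le_int[of "wronskian \<psi> a b" "c ^ k"] pos by simp
  then have "C ^ k \<le> \<bar>real_of_int (wronskian \<psi> a b)\<bar>"
    unfolding C_def by (metis of_int_abs of_int_le_iff of_int_power)
  also have "\<dots> \<le> 2 * C ^ 3 * dual_norm \<psi>"
    unfolding C_def using abs_wronskian_le[OF b] pos \<open>a < c\<close> \<open>b < c\<close> by simp
  also have "\<dots> < 2 * C ^ 3 * C powr (real n * \<eta>)"
  proof (rule mult_strict_left_mono)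
    have "real_of_int (c ^ n) = C powr real n"
      using \<open>C \<ge> 2\<close> by (simp add: C_def powr_realpow)
    then show "dual_norm \<psi> < C powr (real n * \<eta>)"
      using small by (simp add: powr_powr)
  qed (use \<open>C \<ge> 2\<close> in simp)
  \<comment> \<open>The factor 2 is absorbed into one more power of \<open>C\<close>, turning
    exponent 3 into 4.\<close>
  also have "\<dots> \<le> C * C ^ 3 * C powr (real n * \<eta>)"
    using \<open>C \<ge> 2\<close> by (intro mult_right_mono) auto
  also have "\<dots> = C powr (4 + real n * \<eta>)"
  proof -
    have "C * C ^ 3 = C powr 4"
      using \<open>C \<ge> 2\<close> by (simp add: powr_numeral eval_nat_numeral)
    then show ?thesis by (simp add: powr_add)
  qed
  finally have "C powr real k < C powr (4 + real n * \<eta>)"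
    using \<open>C \<ge> 2\<close> by (simp add: powr_realpow)
  then have "real k < 4 + real n * \<eta>"
    using \<open>C \<ge> 2\<close> by simp
  then show False
    using n(1) by (simp add: k algebra_simps)
qed

theorem proposition3p11:
  assumes "small_derivatives_conjecture"
  shows "\<exists>n\<^sub>0::nat. n\<^sub>0 > 0 \<and> (\<forall>n\<ge>n\<^sub>0. \<forall>a b c::int.
           a > 0 \<and> b > 0 \<and> c > 0 \<and> Gcd {a, b, c} = 1 \<longrightarrow> a ^ n + b ^ n \<noteq> c ^ n)"
proof -
  obtain \<eta> :: real and E where "\<eta> < 1" and "finite E" and
    E: "E = {(a, b, c). a > 0 \<and> b > 0 \<and> c > 0 \<and> Gcd {a, b, c} = 1 \<and> a + b = c \<and>
          \<not> one_N_prime_form a b c \<and>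
          \<not> (\<exists>\<psi>\<in>tangent_forms a b. psi_independent \<psi> a b \<and>
                dual_norm \<psi> < real_of_int c powr \<eta>)}"
    using assms unfolding small_derivatives_conjecture_def by blast
  obtain B where B: "\<And>a b c. (a, b, c) \<in> E \<Longrightarrow> c \<le> B"
  proof -
    have "bdd_above ((\<lambda>(a, b, c). c) ` E)"
      using \<open>finite E\<close> by (intro bdd_above_finite) auto
    then show thesis
      using that unfolding bdd_above_def by fastforce
  qed
  \<comment> \<open>The three bounds serve, in order, to exclude prime entries, to push
    \<open>c ^ n\<close> beyond the exceptional triples, and to secure
    \<open>n * (1 - \<eta>) \<ge> 5\<close>.\<close>
  define n\<^sub>0 where "n\<^sub>0 = max 2 (max (nat B) (nat \<lceil>5 / (1 - \<eta>)\<rceil>))"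
  have "a ^ n + b ^ n \<noteq> c ^ n"
    if "n \<ge> n\<^sub>0" and pos: "a > 0" "b > 0" "c > 0" and gcd: "Gcd {a, b, c} = 1"
    for n and a b c :: int
  proof
    assume eq: "a ^ n + b ^ n = c ^ n"
    have "n \<ge> 2" "nat B \<le> n" "nat \<lceil>5 / (1 - \<eta>)\<rceil> \<le> n"
      using \<open>n \<ge> n\<^sub>0\<close> unfolding n\<^sub>0_def by simp_all
    then have n: "n \<ge> 2" "int n \<ge> B" "real n \<ge> 5 / (1 - \<eta>)"
      by linarith+
    then have \<eta>: "real n * (1 - \<eta>) \<ge> 5"
      using \<open>\<eta> < 1\<close> by (simp add: field_simps)
    have cop: "coprime b c"
      using fermat_coprime[OF gcd _ eq] n by simp
    \<comment> \<open>A sum of two positive integers is at least 2; this excludes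
      \<open>c = 1\<close>, whose powers do not grow.\<close>
    have "c ^ n \<noteq> 1"
      using eq zero_less_power[OF pos(1), of n] zero_less_power[OF pos(2), of n] by linarith
    then have "c \<noteq> 1"
      by auto
    then have "2 ^ n \<le> c ^ n"
      using pos by (intro power_mono) auto
    moreover have "int n < 2 ^ n"
      by (metis less_exp of_nat_less_iff of_nat_numeral of_nat_power)
    ultimately have "(a ^ n, b ^ n, c ^ n) \<notin> E"
      using B n(2) by fastforce
    moreover have "Gcd {a ^ n, b ^ n, c ^ n} = 1"
    proof -
      have "gcd (b ^ n) (c ^ n) = 1"
        using cop by (simp flip: coprime_iff_gcd_eq_1)
      then show ?thesis by simp
    qed
    \<comment> \<open>The powers meet every other condition defining \<open>E\<close>, so lying
      outside \<open>E\<close> yields the form.\<close>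
    ultimately obtain \<psi> where "\<psi> \<in> tangent_forms (a ^ n) (b ^ n)"
      "psi_independent \<psi> (a ^ n) (b ^ n)" "dual_norm \<psi> < real_of_int (c ^ n) powr \<eta>"
      using eq pos not_one_N_prime_form_power[OF n(1), of a b c] unfolding E by auto
    then show False
      using no_fermat_solution_of_form[OF pos cop eq \<eta>] n(1) by simp
  qed
  then show ?thesis
    by (intro exI[of _ n\<^sub>0]) (auto simp: n\<^sub>0_def)
qed

end
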